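(* Let $a<b$ be real numbers and let $f:[a,b]\to\mathbb{R}$ be bounded. Let $I=[a,b]$ with the usual metric. Define $s:[I]^{<\infty}\to\mathbb{R}$ as follows: for a finite $H\subset I$ write $H\cup\{a,b\}=\{a_0,\dots,a_n\}$ with $a=a_0<a_1<\dots<a_n=b$, and put \[s(H)=f(a_1)(a_2-a_0)+f(a_3)(a_4-a_2)+\dots+\begin{cases} f(a_{n-1})(a_n-a_{n-2}) & \text{if } n \text{ is even},\\ f(b)(a_n-a_{n-1}) & \text{if } n\text{ is odd,}\end{cases}\] i.e. $s(H)=\sum_{1\le j\le n-1,\ j\text{ odd}} f(a_j)(a_{j+1}-a_{j-1})$, plus the extra term $f(b)(a_n-a_{n-1})$ when $n$ is odd. Then for every $A\in\mathbb{R}$: $f$ is Riemann integrable on $[a,b]$ with $\int_a^b f=A$ if and only if $\mathrm{ext}(s,I)=A$.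
   Context: For a set $I$, $[I]^{<\infty}$ is the set of all finite subsets of $I$. For a pseudo-metric space $(I,d)$, $A\subset I$ and $\epsilon>0$, let $S(A,\epsilon)=\bigcup_{x\in A}\{y\in I: d(x,y)<\epsilon\}$. The Hausdorff pseudo-metric on subsets of $I$ is $d_H(A,C)=\inf\{\epsilon>0: A\subset S(C,\epsilon),\ C\subset S(A,\epsilon)\}$ (with $\inf\emptyset=+\infty$). $I$ is totally bounded if for every $\delta>0$ there is a finite $K\subset I$ with $S(K,\delta)=I$. Let $(I,d)$ be a totally bounded pseudo-metric space, $s:[I]^{<\infty}\to\mathbb{R}$ and $A\in\mathbb{R}$. We write $\mathrm{ext}(s,I)=A$ if for every $\epsilon>0$ there is $\delta>0$ such that $K\in[I]^{<\infty}$ and $d_H(K,I)<\delta$ imply $|s(K)-A|<\epsilon$. *)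

theory Defs
  imports "HOL-Analysis.Analysis"
begin

definition nbhd :: "'a set \<Rightarrow> ('a \<Rightarrow> 'a \<Rightarrow> real) \<Rightarrow> 'a set \<Rightarrow> real \<Rightarrow> 'a set" where
  "nbhd I d A \<epsilon> = (\<Union>x\<in>A. {y \<in> I. d x y < \<epsilon>})"

(* On ereal the infimum of the empty set is \<infinity>. *)
definition hausdorff_pmetric :: "'a set \<Rightarrow> ('a \<Rightarrow> 'a \<Rightarrow> real) \<Rightarrow> 'a set \<Rightarrow> 'a set \<Rightarrow> ereal" where
  "hausdorff_pmetric I d A C =
     Inf (ereal ` {\<epsilon>. \<epsilon> > 0 \<and> A \<subseteq> nbhd I d C \<epsilon> \<and> C \<subseteq> nbhd I d A \<epsilon>})"

definition totally_bounded_pmetric :: "'a set \<Rightarrow> ('a \<Rightarrow> 'a \<Rightarrow> real) \<Rightarrow> bool" where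
  "totally_bounded_pmetric I d \<longleftrightarrow>
     (\<forall>x\<in>I. \<forall>y\<in>I. 0 \<le> d x y \<and> d x y = d y x) \<and>
     (\<forall>x\<in>I. d x x = 0) \<and>
     (\<forall>x\<in>I. \<forall>y\<in>I. \<forall>z\<in>I. d x z \<le> d x y + d y z) \<and>
     (\<forall>\<delta>>0. \<exists>K. finite K \<and> K \<subseteq> I \<and> nbhd I d K \<delta> = I)"

(* has_ext I d s A is the relation ext(s,I) = A. It is meant for totally bounded pseudo-metric
   spaces (I,d), and only the values of s at finite subsets of I matter. *)
definition has_ext :: "'a set \<Rightarrow> ('a \<Rightarrow> 'a \<Rightarrow> real) \<Rightarrow> ('a set \<Rightarrow> real) \<Rightarrow> real \<Rightarrow> bool" where
  "has_ext I d s A \<longleftrightarrow>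
     (\<forall>\<epsilon>>0. \<exists>\<delta>>0. \<forall>K. finite K \<and> K \<subseteq> I \<and> hausdorff_pmetric I d K I < ereal \<delta>
        \<longrightarrow> \<bar>s K - A\<bar> < \<epsilon>)"

lemma totally_bounded_pmetric_interval: "totally_bounded_pmetric {a..b::real} dist"
proof -
  have "\<exists>K. finite K \<and> K \<subseteq> {a..b} \<and> nbhd {a..b} dist K \<delta> = {a..b}" if "\<delta> > 0" for \<delta>
  proof -
    have "compact {a..b}" by simp
    moreover have "open (ball x \<delta>)" for x :: real by simp
    moreover have "{a..b} \<subseteq> (\<Union>x\<in>{a..b}. ball x \<delta>)" using that by force
    ultimately obtain K where "K \<subseteq> {a..b}" "finite K" "{a..b} \<subseteq> (\<Union>x\<in>K. ball x \<delta>)"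
      by (metis compactE_image)
    then show ?thesis
      by (intro exI[of _ K]) (fastforce simp: nbhd_def)
  qed
  then show ?thesis
    by (auto simp: totally_bounded_pmetric_def dist_commute dist_triangle)
qed

(* The Riemann (not the Henstock-Kurzweil) integral: the limit of Riemann sums over tagged
   partitions of [a,b] as the mesh tends to 0. One-point pieces, which tagged_division_of allows,
   have length 0 and contribute nothing. *)
definition has_riemann_integral :: "(real \<Rightarrow> real) \<Rightarrow> real \<Rightarrow> real \<Rightarrow> real \<Rightarrow> bool" where
  "has_riemann_integral f a b A \<longleftrightarrow>
     (\<forall>\<epsilon>>0. \<exists>\<delta>>0. \<forall>\<D>. \<D> tagged_division_of {a..b} \<and> (\<forall>(x, K)\<in>\<D>. measure lborel K < \<delta>)
        \<longrightarrow> \<bar>(\<Sum>(x, K)\<in>\<D>. measure lborel K * f x) - A\<bar> < \<epsilon>)"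

(* as ! j is the point a_j of the enumeration of H \<union> {a, b}. *)
definition alternate_sum :: "(real \<Rightarrow> real) \<Rightarrow> real \<Rightarrow> real \<Rightarrow> real set \<Rightarrow> real" where
  "alternate_sum f a b H =
     (let as = sorted_list_of_set (H \<union> {a, b}); n = length as - 1
      in (\<Sum>j | 1 \<le> j \<and> j \<le> n - 1 \<and> odd j. f (as ! j) * (as ! (j + 1) - as ! (j - 1)))
         + (if odd n then f b * (as ! n - as ! (n - 1)) else 0))"

end

theory Submission
  imports Defs
begin

text \<open>An alternate sum is the Riemann sum over the pieces \<open>[a\<^sub>2\<^sub>i, a\<^sub>2\<^sub>i\<^sub>+\<^sub>2]\<close> (the last one cut off at \<open>b\<close>) with
  tags \<open>a\<^sub>2\<^sub>i\<^sub>+\<^sub>1\<close>, and these pieces are short when \<open>H\<close> is Hausdorff-close to \<open>[a, b]\<close>. Conversely, after merging the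
  pieces of a fine tagged division that have the same tag, and moving its nodes slightly, nodes and
  tags interleave strictly; the Riemann sum is then the alternate sum over the set of all nodes and
  tags. Only the tags at \<open>a\<close> and \<open>b\<close> have to be moved as well, which is where boundedness of \<open>f\<close> enters.\<close>

section \<open>Hausdorff distance from a subset to the whole space\<close>

lemma hausdorff_pmetric_less_imp_near:
  assumes "hausdorff_pmetric I d K I < ereal \<delta>" "y \<in> I"
  shows "\<exists>x\<in>K. d x y < \<delta>"
proof -
  obtain \<epsilon> where "\<epsilon> < \<delta>" "I \<subseteq> nbhd I d K \<epsilon>"
    using assms(1) by (auto simp: hausdorff_pmetric_def Inf_less_iff)
  then obtain x where "x \<in> K" "d x y < \<epsilon>"
    using assms(2) by (auto simp: nbhd_def)
  with \<open>\<epsilon> < \<delta>\<close> show ?thesis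
    by (intro bexI[of _ x]) auto
qed

text \<open>Here \<epsilon> itself belongs to the set whose infimum is taken, and the slack between
  \<epsilon> and \<delta> makes the bound strict. The inclusion of \<open>K\<close> in the
  neighbourhood of \<open>I\<close> comes from \<open>d x x = 0\<close>.\<close>

lemma hausdorff_pmetric_less_if_near:
  assumes "0 < \<epsilon>" "\<epsilon> < \<delta>" "K \<subseteq> I" "\<And>x. x \<in> I \<Longrightarrow> d x x = 0"
    and "\<And>y. y \<in> I \<Longrightarrow> \<exists>x\<in>K. d x y < \<epsilon>"
  shows "hausdorff_pmetric I d K I < ereal \<delta>"
proof -
  have "I \<subseteq> nbhd I d K \<epsilon>" "K \<subseteq> nbhd I d I \<epsilon>"
    using assms by (force simp: nbhd_def)+
  with assms(1,2) show ?thesis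
    unfolding hausdorff_pmetric_def Inf_less_iff by (intro bexI[of _ "ereal \<epsilon>"]) auto
qed

section \<open>Tagged divisions and alternate sums along increasing nodes\<close>

text \<open>Pieces are appended one at a time on the right. The inequality
  \<open>c 0 \<le> c m\<close> is carried through the induction because two adjacent intervals unite
  to a single one only if both are nonempty.\<close>

lemma tagged_division_of_nodes:
  fixes c t :: "nat \<Rightarrow> real"
  assumes "0 < m" "\<And>i. i < m \<Longrightarrow> c i \<le> t i \<and> t i \<le> c (Suc i)"
  shows "c 0 \<le> c m \<and> (\<lambda>i. (t i, {c i..c (Suc i)})) ` {..<m} tagged_division_of {c 0..c m}"
  using assms
proof (induction m rule: nat_induct_non_zero)
  case 1
  then have "c 0 \<le> t 0" "t 0 \<le> c 1"
    by auto
  then show ?case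
    using tagged_division_of_self_real[of "t 0" "c 0" "c 1"] by (simp add: lessThan_Suc)
next
  case (Suc m)
  have IH: "c 0 \<le> c m" "(\<lambda>i. (t i, {c i..c (Suc i)})) ` {..<m} tagged_division_of {c 0..c m}"
    using Suc by simp_all
  have le: "c m \<le> t m" "t m \<le> c (Suc m)"
    using Suc.prems[of m] by auto
  have "(\<lambda>i. (t i, {c i..c (Suc i)})) ` {..<m} \<union> {(t m, {c m..c (Suc m)})}
          tagged_division_of {c 0..c m} \<union> {c m..c (Suc m)}"
    using le by (intro tagged_division_Un IH tagged_division_of_self_real) auto
  moreover have "{c 0..c m} \<union> {c m..c (Suc m)} = {c 0..c (Suc m)}"
    using IH(1) le by auto
  ultimately show ?case
    using IH(1) le by (simp add: lessThan_Suc)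
qed

text \<open>The cut-off \<open>min (2 * i + 2) n\<close> absorbs the case distinction on parity: for
  odd \<open>n\<close> the last index has tag \<open>p n\<close> and piece from
  \<open>p (n - 1)\<close> to \<open>p n\<close>, which is the extra term.\<close>

lemma alternate_sum_strictly_increasing:
  fixes p :: "nat \<Rightarrow> real"
  assumes "0 < n" "\<And>i. i < n \<Longrightarrow> p i < p (Suc i)"
  shows "alternate_sum f (p 0) (p n) (p ` {..n}) =
    (\<Sum>i<(n + 1) div 2. f (p (2 * i + 1)) * (p (min (2 * i + 2) n) - p (2 * i)))"
proof -
  define as where "as = map p [0..<Suc n]"
  have "sorted_wrt (<) as"
    using assms(2) unfolding sorted_wrt_iff_nth_Suc_transp[OF transp_on_less] as_def
    by (auto simp del: upt_Suc)
  then have "sorted_list_of_set (set as) = as"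
    by (simp add: sorted_list_of_set.idem_if_sorted_distinct strict_sorted_iff)
  moreover have "set as = p ` {..n} \<union> {p 0, p n}"
    by (auto simp: as_def simp del: upt_Suc)
  ultimately have *: "sorted_list_of_set (p ` {..n} \<union> {p 0, p n}) = as"
    by simp
  have as_nth: "as ! i = p i" if "i \<le> n" for i
    using that by (simp add: as_def del: upt_Suc)
  have "length as - 1 = n"
    by (simp add: as_def)
  then have eq: "alternate_sum f (p 0) (p n) (p ` {..n}) =
      (\<Sum>j | 1 \<le> j \<and> j \<le> n - 1 \<and> odd j. f (p j) * (p (j + 1) - p (j - 1)))
         + (if odd n then f (p n) * (p n - p (n - 1)) else 0)"
    unfolding alternate_sum_def * Let_def using assms(1)
    by (intro arg_cong2[where f="(+)"] sum.cong) (auto simp: as_nth)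
  have "(\<Sum>j | 1 \<le> j \<and> j \<le> n - 1 \<and> odd j. f (p j) * (p (j + 1) - p (j - 1))) =
      (\<Sum>i<n div 2. f (p (2 * i + 1)) * (p (2 * i + 2) - p (2 * i)))"
    by (rule sum.reindex_bij_witness[of _ "\<lambda>i. 2 * i + 1" "\<lambda>j. j div 2"])
       (use assms(1) in \<open>auto elim!: oddE\<close>)
  also have "\<dots> = (\<Sum>i<n div 2. f (p (2 * i + 1)) * (p (min (2 * i + 2) n) - p (2 * i)))"
    by (intro sum.cong) (auto simp: min_def)
  finally show ?thesis
    unfolding eq by (cases "even n") (auto elim!: evenE oddE simp: min_def)
qed

text \<open>Nodes take the even and tags the odd positions of one strictly increasing sequence. Its
  last index \<open>2 * m\<close> is even, so the extra term is absent.\<close>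

lemma alternate_sum_interleaved:
  fixes c t :: "nat \<Rightarrow> real"
  assumes "0 < m" "\<And>i. i < m \<Longrightarrow> c i < t i \<and> t i < c (Suc i)"
  shows "alternate_sum f (c 0) (c m) (c ` {..m} \<union> t ` {..<m}) = (\<Sum>i<m. f (t i) * (c (Suc i) - c i))"
proof -
  define p where "p k = (if even k then c (k div 2) else t (k div 2))" for k
  have "p ` {..2 * m} = c ` {..m} \<union> t ` {..<m}"
  proof (intro equalityI subsetI)
    fix x assume "x \<in> c ` {..m} \<union> t ` {..<m}"
    then consider i where "i \<le> m" "x = p (2 * i)" | i where "i < m" "x = p (2 * i + 1)"
      by (auto simp: p_def)
    then show "x \<in> p ` {..2 * m}"
      by cases auto
  qed (auto simp: p_def elim!: oddE)
  moreover have "p i < p (Suc i)" if "i < 2 * m" for i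
    using that assms(2)[of "i div 2"] by (auto simp: p_def elim!: evenE oddE)
  ultimately have "alternate_sum f (p 0) (p (2 * m)) (c ` {..m} \<union> t ` {..<m}) =
      (\<Sum>i<m. f (p (2 * i + 1)) * (p (min (2 * i + 2) (2 * m)) - p (2 * i)))"
    using alternate_sum_strictly_increasing[of "2 * m" p f] assms(1) by simp
  then show ?thesis
    by (auto simp: p_def intro!: sum.cong)
qed

lemma finite_set_strictly_increasing_enum:
  fixes H :: "'a::linorder set"
  assumes "finite H" "a \<in> H" "b \<in> H" "a < b" "H \<subseteq> {a..b}"
  obtains n p where "0 < n" "H = p ` {..n::nat}" "p 0 = a" "p n = b" "\<And>i. i < n \<Longrightarrow> p i < p (Suc i)"
proof -
  define p where "p = (!) (sorted_list_of_set H)"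
  define n where "n = card H - 1"
  have "card {a, b} \<le> card H"
    using assms by (intro card_mono) auto
  then have n: "card H = Suc n" "0 < n"
    using assms(4) by (auto simp: n_def)
  have "set (sorted_list_of_set H) = p ` {..n}"
    unfolding set_conv_nth p_def using n by (auto simp: less_Suc_eq_le)
  then have H: "H = p ` {..n}"
    using assms(1) by simp
  have less: "p i < p j" if "i < j" "j \<le> n" for i j
    unfolding p_def using that n by (intro sorted_wrt_nth_less[where P="(<)"]) auto
  obtain i j where ij: "a = p i" "i \<le> n" "b = p j" "j \<le> n"
    using assms(2,3) H by auto
  have "\<not> 0 < i" "\<not> j < n"
    using less[of 0 i] less[of j n] ij assms(5) H by (force simp: image_subset_iff not_le)+
  with ij have "p 0 = a" "p n = b"
    by auto
  with n H less show thesis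
    by (intro that[of n p]) auto
qed

section \<open>Merging the pieces of a tagged division that share a tag\<close>

text \<open>A partial division is a division of the union of its own pieces, so subadditivity of the
  content applies.\<close>

lemma sum_content_tagged_partial_division_le:
  fixes u v :: real
  assumes "\<D> tagged_partial_division_of S" "\<And>x K. (x, K) \<in> \<D> \<Longrightarrow> K \<subseteq> {u..v}" "u \<le> v"
  shows "(\<Sum>(x, K)\<in>\<D>. measure lborel K) \<le> v - u"
proof -
  have D: "\<D> tagged_division_of \<Union> (snd ` \<D>)"
    using assms(1) by (rule tagged_partial_division_of_Union_self)
  \<comment> \<open>Forgetting the tags loses nothing: an interval that occurs with two tags has
    empty interior and hence content 0.\<close>
  have "(\<Sum>(x, K)\<in>\<D>. measure lborel K) = sum (measure lborel) (snd ` \<D>)"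
    by (intro sum.over_tagged_division_lemma[OF D]) (auto simp: content_eq_0_interior)
  also have "\<dots> \<le> measure lborel (cbox u v)"
    by (rule subadditive_content_division[OF division_of_tagged_division[OF D]])
       (use assms(2) in force)
  finally show ?thesis
    using assms(3) by simp
qed

text \<open>Otherwise \<open>K\<close> would contain a neighbourhood of \<open>y\<close> and overlap \<open>L\<close>.\<close>

lemma tagged_partial_division_between:
  fixes x y z :: real
  assumes "\<D> tagged_partial_division_of S" "(x, K) \<in> \<D>" "(y, L) \<in> \<D>" "measure lborel L > 0" "z \<in> K"
  shows "\<not> (x < y \<and> y < z)" "\<not> (z < y \<and> y < x)"
proof -
  note D = tagged_partial_division_ofD[OF assms(1)]
  obtain u v where L: "L = cbox u v" "u < v"
    using D(4)[OF assms(3)] assms(4) by (auto simp: content_real_if split: if_splits)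
  obtain k l where K: "K = cbox k l"
    using D(4)[OF assms(2)] by blast
  have "u \<le> y" "y \<le> v" "k \<le> x" "x \<le> l" "k \<le> z" "z \<le> l"
    using D(2)[OF assms(2)] D(2)[OF assms(3)] assms(5) by (auto simp: L K)
  moreover have "max k u < min l v \<longrightarrow> x = y"
  proof
    assume "max k u < min l v"
    then have "(max k u + min l v) / 2 \<in> interior K \<inter> interior L"
      by (auto simp: K L field_simps max_def min_def)
    then show "x = y"
      using D(5)[OF assms(2,3)] by auto
  qed
  ultimately show "\<not> (x < y \<and> y < z)" "\<not> (z < y \<and> y < x)"
    using L(2) by auto
qed


text \<open>Degenerate pieces are dropped and pieces with equal tags are merged; the node \<open>c i\<close> is
  \<open>a\<close> plus the total length of the pieces whose tag is one of the first \<open>i\<close> tags.\<close>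

lemma tagged_division_sorted_tags:
  fixes a b \<mu> :: real and f :: "real \<Rightarrow> real"
  assumes "a < b" "\<D> tagged_division_of {a..b}" "\<forall>(x, K)\<in>\<D>. measure lborel K < \<mu>"
  obtains m and c t :: "nat \<Rightarrow> real"
  where "0 < m" "c 0 = a" "c m = b"
    "\<And>i. i < m \<Longrightarrow> c i \<le> t i \<and> t i \<le> c (Suc i)"
    "\<And>i. i < m \<Longrightarrow> c (Suc i) - c i \<le> 2 * \<mu>"
    "\<And>i j. i < j \<Longrightarrow> j < m \<Longrightarrow> t i < t j"
    "(\<Sum>(x, K)\<in>\<D>. measure lborel K * f x) = (\<Sum>i<m. f (t i) * (c (Suc i) - c i))"
proof -
  note D = tagged_division_ofD[OF assms(2)]
  define \<D>' where "\<D>' = {(x, K)\<in>\<D>. measure lborel K > 0}"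
  define T where "T = fst ` \<D>'"
  define L where "L x = (\<Sum>(y, K)\<in>{p\<in>\<D>'. fst p = x}. measure lborel K)" for x
  have fin: "finite \<D>'" "finite T"
    using D(1) by (auto simp: \<D>'_def T_def intro: finite_subset)
  have part: "\<D>' tagged_partial_division_of {a..b}"
    using assms(2) unfolding tagged_division_of_def
    by (elim conjE tagged_partial_division_subset) (auto simp: \<D>'_def)
  note D' = tagged_partial_division_ofD[OF part]
  \<comment> \<open>Kept general in \<open>g\<close>: the constant 1 yields the total length, and
    \<open>f\<close> yields the Riemann sum.\<close>
  have sum_D': "(\<Sum>(x, K)\<in>\<D>. measure lborel K * g x) = (\<Sum>x\<in>T. g x * L x)" for g
  proof -
    have "(\<Sum>(x, K)\<in>\<D>. measure lborel K * g x) = (\<Sum>(x, K)\<in>\<D>'. measure lborel K * g x)"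
      by (rule sum.mono_neutral_right) (use D(1) in \<open>auto simp: \<D>'_def zero_less_measure_iff\<close>)
    also have "\<dots> = (\<Sum>x\<in>T. \<Sum>(y, K)\<in>{p\<in>\<D>'. fst p = x}. measure lborel K * g y)"
      unfolding T_def by (rule sum.image_gen[OF fin(1)])
    also have "\<dots> = (\<Sum>x\<in>T. g x * L x)"
      unfolding L_def sum_distrib_left by (intro sum.cong) auto
    finally show ?thesis .
  qed
  have L_total: "sum L T = b - a"
    using sum_D'[of "\<lambda>_. 1"] additive_content_tagged_division[of \<D> a b] assms(1,2) by simp
  have L_le: "sum L S \<le> v - u" 
    if "S \<subseteq> T" "\<And>x K. x \<in> S \<Longrightarrow> (x, K) \<in> \<D>' \<Longrightarrow> K \<subseteq> {u..v}" "u \<le> v" for S u v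
  proof -
    have "sum L S = (\<Sum>(x, K)\<in>{p\<in>\<D>'. fst p \<in> S}. measure lborel K)"
    proof -
      have "finite S"
        using that(1) fin(2) by (rule finite_subset)
      moreover have "finite {p\<in>\<D>'. fst p \<in> S}"
        using fin(1) by simp
      moreover have "sum L S = (\<Sum>x\<in>S. \<Sum>(y, K)\<in>{p\<in>{p\<in>\<D>'. fst p \<in> S}. fst p = x}. measure lborel K)"
        unfolding L_def by (intro sum.cong) auto
      ultimately show ?thesis
        using sum.group[of "{p\<in>\<D>'. fst p \<in> S}" S fst "\<lambda>(x, K). measure lborel K"]
        by (metis (no_types, lifting) image_Collect_subsetI)
    qed
    also have "\<dots> \<le> v - u"
      by (rule sum_content_tagged_partial_division_le[OF tagged_partial_division_subset[OF part]])
         (use that in auto)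
    finally show ?thesis .
  qed
  have T_ab: "x \<in> {a..b}" if "x \<in> T" for x
    using that D'(2,3) by (fastforce simp: T_def)
  \<comment> \<open>A piece with tag below \<open>y\<close> cannot reach beyond \<open>y\<close>,
    since \<open>y\<close> is the tag of a nondegenerate piece. All these pieces therefore fit into
    \<open>{a..y}\<close>; \<open>right\<close> is the mirror image.\<close>
  have left: "sum L S \<le> y - a" if S: "S \<subseteq> T" and y: "y \<in> T" and less: "\<And>x. x \<in> S \<Longrightarrow> x < y" for S y
  proof (rule L_le[OF S])
    fix x K assume "x \<in> S" "(x, K) \<in> \<D>'"
    moreover obtain K' where "(y, K') \<in> \<D>'" "measure lborel K' > 0"
      using y by (auto simp: T_def \<D>'_def)
    ultimately show "K \<subseteq> {a..y}"
      using tagged_partial_division_between(1)[OF part, of x K y K'] D'(3)[of x K] less[of x] by force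
  qed (use T_ab y in auto)
  have right: "sum L S \<le> b - y" if S: "S \<subseteq> T" and y: "y \<in> T" and less: "\<And>x. x \<in> S \<Longrightarrow> y < x" for S y
  proof (rule L_le[OF S])
    fix x K assume "x \<in> S" "(x, K) \<in> \<D>'"
    moreover obtain K' where "(y, K') \<in> \<D>'" "measure lborel K' > 0"
      using y by (auto simp: T_def \<D>'_def)
    ultimately show "K \<subseteq> {y..b}"
      using tagged_partial_division_between(2)[OF part, of x K y K'] D'(3)[of x K] less[of x] by force
  qed (use T_ab y in auto)
  \<comment> \<open>Every piece tagged \<open>x\<close> contains \<open>x\<close> and is shorter
    than \<mu>, so it extends at most \<mu> to either side; this is the source of the factor
    2.\<close>
  have L_mesh: "L x \<le> 2 * \<mu>" if "x \<in> T" for x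
  proof -
    have "K \<subseteq> {x - \<mu>..x + \<mu>}" if "(x, K) \<in> \<D>'" for K
      using D'(2)[OF that] D'(4)[OF that] assms(3) that
      by (force simp: \<D>'_def content_real_if)
    moreover have "0 \<le> \<mu>"
      using that assms(3) by (force simp: T_def \<D>'_def)
    ultimately show ?thesis
      using L_le[of "{x}" "x - \<mu>" "x + \<mu>"] that by auto
  qed
  define m where "m = card T"
  define t where "t = (!) (sorted_list_of_set T)"
  define c where "c i = a + (\<Sum>j<i. L (t j))" for i
  have t_less: "t i < t j" if "i < j" "j < m" for i j
    unfolding t_def using that by (intro sorted_wrt_nth_less[where P="(<)"]) (auto simp: m_def)
  have bij: "bij_betw t {..<m} T"
    unfolding t_def m_def using fin(2) by (intro bij_betw_nth) auto
  have sum_t: "sum g (t ` S) = (\<Sum>j\<in>S. g (t j))" if "S \<subseteq> {..<m}" for g :: "real \<Rightarrow> real" and S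
    using bij that by (intro sum.reindex_cong[of t]) (auto simp: bij_betw_def inj_on_subset)
  have sum_T: "(\<Sum>x\<in>T. g x) = (\<Sum>j<m. g (t j))" for g :: "real \<Rightarrow> real"
    using sum_t[of "{..<m}" g] bij by (simp add: bij_betw_def)
  have tT: "t i \<in> T" if "i < m" for i
    using bij that by (auto simp: bij_betw_def)
  have cm: "c m = b"
    using L_total by (simp add: c_def sum_T)
  show thesis
  proof (rule that[of m c t])
    show "0 < m"
      using cm assms(1) by (cases m) (auto simp: c_def)
    show "c 0 = a" "c m = b"
      using cm by (simp_all add: c_def)
    fix i assume i: "i < m"
    \<comment> \<open>The pieces with smaller tags give \<open>c i \<le> t i\<close>. Those with
      larger tags, measured back from \<open>c m = b\<close>, give
      \<open>t i \<le> c (Suc i)\<close>.\<close>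
    have "(\<Sum>j<i. L (t j)) \<le> t i - a"
      using left[of "t ` {..<i}" "t i"] i tT t_less sum_t[of "{..<i}" L] by fastforce
    moreover have "(\<Sum>j\<in>{Suc i..<m}. L (t j)) \<le> b - t i"
      using right[of "t ` {Suc i..<m}" "t i"] i tT t_less sum_t[of "{Suc i..<m}" L] by fastforce
    moreover have "c m = c (Suc i) + (\<Sum>j\<in>{Suc i..<m}. L (t j))"
      using i sum.atLeastLessThan_concat[of 0 "Suc i" m "\<lambda>j. L (t j)"]
      by (simp add: c_def lessThan_atLeast0)
    ultimately show "c i \<le> t i \<and> t i \<le> c (Suc i)"
      using cm by (auto simp: c_def)
    show "c (Suc i) - c i \<le> 2 * \<mu>"
      using L_mesh[OF tT[OF i]] by (simp add: c_def)
  next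
    show "(\<Sum>(x, K)\<in>\<D>. measure lborel K * f x) = (\<Sum>i<m. f (t i) * (c (Suc i) - c i))"
      unfolding sum_D' sum_T by (simp add: c_def)
  qed (rule t_less)
qed

section \<open>Strict interleaving of nodes and tags\<close>

lemma between_near:
  fixes u v x \<eta> :: real
  assumes "u < v" "u \<le> x" "x \<le> v" "0 < \<eta>"
  obtains y where "u < y" "y < v" "\<bar>y - x\<bar> \<le> \<eta>"
proof -
  have "x \<in> closure {u<..<v}"
    using assms by simp
  with that \<open>0 < \<eta>\<close> show thesis
    by (auto simp: closure_approachable dist_real_def dest!: spec[of _ \<eta>])
qed

text \<open>Moving the nodes by at most \<open>\<eta>\<close> separates them from the tags, except for a tag at \<open>a\<close> or \<open>b\<close>;
  such a tag is moved to the midpoint of its piece, which is harmless since \<open>f\<close> is bounded and the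
  piece is short.\<close>

lemma interleaving_near:
  fixes c t :: "nat \<Rightarrow> real" and a b \<eta> \<nu> M :: real and f :: "real \<Rightarrow> real"
  assumes "a < b" "0 < m" "c 0 = a" "c m = b" "0 < \<eta>"
    and ct: "\<And>i. i < m \<Longrightarrow> c i \<le> t i \<and> t i \<le> c (Suc i)"
    and mesh: "\<And>i. i < m \<Longrightarrow> c (Suc i) - c i \<le> \<nu>"
    and t_less: "\<And>i j. i < j \<Longrightarrow> j < m \<Longrightarrow> t i < t j"
    and M: "\<And>x. x \<in> {a..b} \<Longrightarrow> \<bar>f x\<bar> \<le> M"
  obtains c' t' :: "nat \<Rightarrow> real"
  where "c' 0 = a" "c' m = b" "\<And>i. i < m \<Longrightarrow> c' i < t' i \<and> t' i < c' (Suc i)"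
    "\<And>i. i \<le> m \<Longrightarrow> \<bar>c' i - c i\<bar> \<le> \<eta>"
    "\<bar>(\<Sum>i<m. f (t i) * (c (Suc i) - c i)) - (\<Sum>i<m. f (t' i) * (c' (Suc i) - c' i))\<bar>
      \<le> 2 * M * real m * \<eta> + 4 * M * \<nu>"
proof -
  \<comment> \<open>An inner node lies between two distinct consecutive tags, so it can be pushed
    strictly between them; the end nodes stay. The guards make the claim hold for every
    \<open>i\<close>, as the choice of \<open>c'\<close> requires.\<close>
  have "\<exists>y. (i = 0 \<longrightarrow> y = a) \<and> (i = m \<longrightarrow> y = b) \<and> (0 < i \<and> i < m \<longrightarrow> t (i - 1) < y \<and> y < t i)
      \<and> (i \<le> m \<longrightarrow> \<bar>y - c i\<bar> \<le> \<eta>)" for i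
  proof (cases "0 < i \<and> i < m")
    case True
    then have "t (i - 1) < t i" "t (i - 1) \<le> c i" "c i \<le> t i"
      using t_less[of "i - 1" i] ct[of "i - 1"] ct[of i] by auto
    from between_near[OF this \<open>0 < \<eta>\<close>]
    obtain y where "t (i - 1) < y" "y < t i" "\<bar>y - c i\<bar> \<le> \<eta>" .
    with True show ?thesis
      by (intro exI[of _ y]) auto
  next
    case False
    with assms(2-5) show ?thesis
      by (intro exI[of _ "c i"]) auto
  qed
  then obtain c' where c': "c' 0 = a" "c' m = b" "\<And>i. i \<le> m \<Longrightarrow> \<bar>c' i - c i\<bar> \<le> \<eta>"
      "\<And>i. 0 < i \<Longrightarrow> i < m \<Longrightarrow> t (i - 1) < c' i \<and> c' i < t i"
    by metis
  have cmono: "c i \<le> c j" if "i \<le> j" "j \<le> m" for i j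
    using that
  proof (induction j rule: dec_induct)
    case (step j)
    then show ?case using ct[of j] by auto
  qed simp
  have t_ab: "a \<le> t i" "t i \<le> b" if "i < m" for i
    using ct[OF that] cmono[of 0 i] cmono[of "Suc i" m] that assms(3,4) by auto
  \<comment> \<open>Strictness can fail only next to an end node, when the first tag is
    \<open>a\<close> or the last tag is \<open>b\<close>.\<close>
  have lower: "c' i \<le> t i \<and> (i \<noteq> 0 \<longrightarrow> c' i < t i)" if "i < m" for i
    using c'(1) c'(4)[of i] t_ab[OF that] that by (cases "i = 0") auto
  have upper: "t i \<le> c' (Suc i) \<and> (Suc i \<noteq> m \<longrightarrow> t i < c' (Suc i))" if "i < m" for i
    using c'(2) c'(4)[of "Suc i"] t_ab[OF that] that by (cases "Suc i = m") auto
  have c'_less: "c' i < c' (Suc i)" if "i < m" for i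
  \<comment> \<open>With a single piece both neighbouring nodes are end nodes, and strictness must
    come from \<open>a < b\<close>; otherwise \<open>lower\<close> or \<open>upper\<close> is
    strict.\<close>
  proof (cases "m = 1")
    case True
    with that c'(1,2) assms(1) show ?thesis by simp
  next
    case False
    then have "i \<noteq> 0 \<or> Suc i \<noteq> m"
      using assms(2) by auto
    then show ?thesis
      using lower[OF that] upper[OF that] by linarith
  qed
  define t' where "t' i = (if t i = a \<or> t i = b then (c' i + c' (Suc i)) / 2 else t i)" for i
  have t': "c' i < t' i \<and> t' i < c' (Suc i)" if "i < m" for i
  proof (cases "t i = a \<or> t i = b")
    case True
    then show ?thesis
      using c'_less[OF that] by (auto simp: t'_def field_simps)
  next
    case False
    have "c' i \<noteq> t i"
      using False c'(1) lower[OF that] by (cases "i = 0") auto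
    moreover have "c' (Suc i) \<noteq> t i"
      using False c'(2) upper[OF that] by (cases "Suc i = m") auto
    ultimately show ?thesis
      using False lower[OF that] upper[OF that] by (simp add: t'_def)
  qed
  have t'_ab: "t' i \<in> {a..b}" if "i < m" for i
  proof -
    have "c' i \<in> {a..b}" if "i \<le> m" for i
    proof (cases "i = 0 \<or> i = m")
      case True
      with c'(1,2) assms(1) show ?thesis by auto
    next
      case False
      with that have "i - 1 < m" "0 < i" "i < m" by auto
      then show ?thesis
        using c'(4)[of i] t_ab(1)[of "i - 1"] t_ab(2)[of i] by simp
    qed
    from this[of i] this[of "Suc i"] show ?thesis
      using t'[OF that] that by simp
  qed
  have M0: "0 \<le> M"
    using M[of a] assms(1) by auto
  \<comment> \<open>Moving both nodes of a piece changes its length by at most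
    \<open>2 * \<eta>\<close>. Moving a tag changes the value by at most \<open>2 * M\<close>, on a
    length of at most \<nu>. The tags increase strictly, so only the first and the last piece incur
    this second cost; for \<open>m = 1\<close> they coincide and the bound counts it twice.\<close>
  have term_le: "\<bar>f (t i) * (c (Suc i) - c i) - f (t' i) * (c' (Suc i) - c' i)\<bar>
      \<le> 2 * M * \<eta> + ((if i = 0 then 2 * M * \<nu> else 0) + (if i = m - 1 then 2 * M * \<nu> else 0))"
    if i: "i < m" for i
  proof -
    have len: "0 \<le> c (Suc i) - c i" "c (Suc i) - c i \<le> \<nu>"
      using mesh[OF i] ct[OF i] by auto
    have f: "\<bar>f (t i)\<bar> \<le> M" "\<bar>f (t' i)\<bar> \<le> M"
      using M[of "t i"] M[of "t' i"] t_ab[OF i] t'_ab[OF i] by auto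
    have "\<bar>f (t' i) * ((c (Suc i) - c i) - (c' (Suc i) - c' i))\<bar> \<le> M * (2 * \<eta>)"
      unfolding abs_mult using f(2) c'(3)[of i] c'(3)[of "Suc i"] i by (intro mult_mono) auto
    moreover have "\<bar>(f (t i) - f (t' i)) * (c (Suc i) - c i)\<bar>
        \<le> (if i = 0 then 2 * M * \<nu> else 0) + (if i = m - 1 then 2 * M * \<nu> else 0)"
    proof (cases "i = 0 \<or> i = m - 1")
      case True
      have "\<bar>(f (t i) - f (t' i)) * (c (Suc i) - c i)\<bar> \<le> (2 * M) * \<nu>"
        unfolding abs_mult using f len by (intro mult_mono) auto
      moreover have "0 \<le> 2 * M * \<nu>"
        using M0 len by auto
      ultimately show ?thesis
        using True by auto
    next
      case False
      then have "t 0 < t i" "t i < t (m - 1)"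
        using t_less[of 0 i] t_less[of i "m - 1"] i by auto
      then have "t' i = t i"
        using t_ab(1)[of 0] t_ab(2)[of "m - 1"] i by (auto simp: t'_def)
      with False show ?thesis by simp
    qed
    moreover have "f (t i) * (c (Suc i) - c i) - f (t' i) * (c' (Suc i) - c' i) =
        f (t' i) * ((c (Suc i) - c i) - (c' (Suc i) - c' i)) + (f (t i) - f (t' i)) * (c (Suc i) - c i)"
      by (simp add: algebra_simps)
    ultimately show ?thesis
      by linarith
  qed
  have "\<bar>(\<Sum>i<m. f (t i) * (c (Suc i) - c i)) - (\<Sum>i<m. f (t' i) * (c' (Suc i) - c' i))\<bar>
      \<le> (\<Sum>i<m. 2 * M * \<eta> + ((if i = 0 then 2 * M * \<nu> else 0) + (if i = m - 1 then 2 * M * \<nu> else 0)))"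
    unfolding sum_subtractf[symmetric] by (rule order_trans[OF sum_abs sum_mono]) (use term_le in auto)
  also have "\<dots> = 2 * M * real m * \<eta> + 4 * M * \<nu>"
    using assms(2) by (simp add: sum.distrib)
  finally show thesis
    using that[OF c'(1,2) t' c'(3)] by blast
qed

section \<open>Passing between Riemann sums and alternate sums\<close>

lemma tagged_division_near_alternate_sum:
  fixes a b \<mu> \<delta> \<epsilon> M :: real and f :: "real \<Rightarrow> real"
  assumes "a < b" "\<D> tagged_division_of {a..b}" "\<forall>(x, K)\<in>\<D>. measure lborel K < \<mu>"
    and M: "\<And>x. x \<in> {a..b} \<Longrightarrow> \<bar>f x\<bar> \<le> M"
    and "0 < \<mu>" "0 < M" "4 * \<mu> \<le> \<delta>" "16 * M * \<mu> \<le> \<epsilon>"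
  obtains K where "finite K" "K \<subseteq> {a..b}" "hausdorff_pmetric {a..b} dist K {a..b} < ereal \<delta>"
    "\<bar>(\<Sum>(x, K)\<in>\<D>. measure lborel K * f x) - alternate_sum f a b K\<bar> \<le> \<epsilon>"
proof -
  obtain m c t where ct: "0 < m" "c 0 = a" "c m = b"
    "\<And>i. i < m \<Longrightarrow> c i \<le> t i \<and> t i \<le> c (Suc i)"
    "\<And>i. i < m \<Longrightarrow> c (Suc i) - c i \<le> 2 * \<mu>"
    "\<And>i j. i < j \<Longrightarrow> j < m \<Longrightarrow> t i < t j"
    "(\<Sum>(x, K)\<in>\<D>. measure lborel K * f x) = (\<Sum>i<m. f (t i) * (c (Suc i) - c i))"
    by (rule tagged_division_sorted_tags[OF assms(1-3), where f = f]) (rule that)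
  \<comment> \<open>Dividing by \<open>m\<close> keeps the total cost of moving the nodes at
    \<open>2 * M * \<mu>\<close>, however many pieces there are.\<close>
  define \<eta> where "\<eta> = \<mu> / real m"
  have \<eta>: "0 < \<eta>" "\<eta> \<le> \<mu>" "real m * \<eta> = \<mu>"
    using ct(1) assms(5) by (auto simp: \<eta>_def field_simps)
  obtain c' t' where c't': "c' 0 = a" "c' m = b" "\<And>i. i < m \<Longrightarrow> c' i < t' i \<and> t' i < c' (Suc i)"
    "\<And>i. i \<le> m \<Longrightarrow> \<bar>c' i - c i\<bar> \<le> \<eta>"
    "\<bar>(\<Sum>i<m. f (t i) * (c (Suc i) - c i)) - (\<Sum>i<m. f (t' i) * (c' (Suc i) - c' i))\<bar>
      \<le> 2 * M * real m * \<eta> + 4 * M * (2 * \<mu>)"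
    by (rule interleaving_near[where c = c and t = t and f = f,
          OF assms(1) ct(1-3) \<eta>(1) ct(4-6) M]) (assumption | rule that)+
  define K where "K = c' ` {..m} \<union> t' ` {..<m}"
  have c'_mono: "c' i \<le> c' j" if "i \<le> j" "j \<le> m" for i j
    using that
  proof (induction j rule: dec_induct)
    case (step j)
    then show ?case using c't'(3)[of j] by auto
  qed simp
  have c'_ab: "c' i \<in> {a..b}" if "i \<le> m" for i
    using c'_mono[of 0 i] c'_mono[of i m] that c't'(1,2) by auto
  have "t' i \<in> {a..b}" if "i < m" for i
    using c't'(3)[OF that] c'_ab[of i] c'_ab[of "Suc i"] that by simp
  with c'_ab have K: "finite K" "K \<subseteq> {a..b}"
    by (auto simp: K_def)
  \<comment> \<open>The left node of the piece around \<open>y\<close> is within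
    \<open>2 * \<mu>\<close> and moved by at most \<mu>. The value \<open>7 / 2\<close> lies
    strictly between this 3 and the 4 in \<open>4 * \<mu> \<le> \<delta>\<close>.\<close>
  have near: "\<exists>x\<in>K. dist x y < 7 / 2 * \<mu>" if "y \<in> {a..b}" for y
  proof -
    have "y \<in> \<Union>{K. \<exists>x. (x, K) \<in> (\<lambda>i. (t i, {c i..c (Suc i)})) ` {..<m}}"
      using tagged_division_of_nodes[of m c t] that ct(1-4) by (auto simp: tagged_division_of_def)
    then obtain i where i: "i < m" "c i \<le> y" "y \<le> c (Suc i)"
      by auto
    have "\<bar>c' i - y\<bar> \<le> 3 * \<mu>"
      using i ct(5)[OF i(1)] c't'(4)[of i] \<eta>(2) by auto
    then show ?thesis
      using i(1) assms(5,7) by (intro bexI[of _ "c' i"]) (auto simp: K_def dist_real_def)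
  qed
  show thesis
  proof (rule that[OF K])
    show "hausdorff_pmetric {a..b} dist K {a..b} < ereal \<delta>"
      using hausdorff_pmetric_less_if_near[OF _ _ K(2) _ near] assms(5,7) by auto
    have "alternate_sum f a b K = (\<Sum>i<m. f (t' i) * (c' (Suc i) - c' i))"
      using alternate_sum_interleaved[of m c' t' f] ct(1) c't'(1-3) by (simp add: K_def)
    moreover have "2 * M * real m * \<eta> + 4 * M * (2 * \<mu>) = 10 * M * \<mu>"
      using \<eta>(3) by (simp add: mult.assoc)
    moreover have "10 * M * \<mu> \<le> \<epsilon>"
      using assms(5,6,8) mult_pos_pos[of M \<mu>] by linarith
    ultimately show "\<bar>(\<Sum>(x, K)\<in>\<D>. measure lborel K * f x) - alternate_sum f a b K\<bar> \<le> \<epsilon>"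
      using c't'(5) unfolding ct(7) by linarith
  qed
qed

text \<open>A piece spans at most two gaps between consecutive points, each shorter than
  \<open>2 * \<delta>\<close>, so its length stays below \<open>4 * \<delta>\<close> and a fortiori
  below \<open>5 * \<delta>\<close>.\<close>

lemma alternate_sum_is_riemann_sum:
  fixes a b \<delta> :: real and f :: "real \<Rightarrow> real"
  assumes "a < b" "finite K" "K \<subseteq> {a..b}" "hausdorff_pmetric {a..b} dist K {a..b} < ereal \<delta>"
  obtains \<D> where "\<D> tagged_division_of {a..b}" "\<forall>(x, J)\<in>\<D>. measure lborel J < 5 * \<delta>"
    "alternate_sum f a b K = (\<Sum>(x, J)\<in>\<D>. measure lborel J * f x)"
proof -
  have fin: "finite (K \<union> {a, b})" "K \<union> {a, b} \<subseteq> {a..b}"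
    using assms by auto
  obtain n p where p: "0 < n" "K \<union> {a, b} = p ` {..n::nat}" "p 0 = a" "p n = b"
    "\<And>i. i < n \<Longrightarrow> p i < p (Suc i)"
    by (rule finite_set_strictly_increasing_enum[OF fin(1) _ _ assms(1) fin(2)]) auto
  have p_less: "p i < p j" if "i < j" "j \<le> n" for i j
  proof -
    have "Suc i \<le> j"
      using that(1) by simp
    then show ?thesis
      using that(2)
    proof (induction j rule: dec_induct)
      case base
      then show ?case using p(5)[of i] by simp
    next
      case (step j)
      then show ?case using p(5)[of j] by simp
    qed
  qed
  have p_le: "p i \<le> p j" if "i \<le> j" "j \<le> n" for i j
    using p_less[of i j] that by (cases "i = j") auto
  have gap: "p (Suc i) - p i < 2 * \<delta>" if i: "i < n" for i
  proof -
    \<comment> \<open>Some point of \<open>K\<close> is within \<delta> of the midpoint of the gap,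
      yet no point lies strictly inside the gap; half the gap is thus shorter than \<delta>.\<close>
    define y where "y = (p i + p (Suc i)) / 2"
    have "y \<in> {a..b}"
      using p_le[of 0 i] p_le[of "Suc i" n] p(5)[OF i] i p(3,4) by (auto simp: y_def)
    then obtain x where x: "x \<in> K" "dist x y < \<delta>"
      using hausdorff_pmetric_less_imp_near[OF assms(4)] by blast
    then obtain j where j: "j \<le> n" "x = p j"
      using p(2) by auto
    have "x \<le> p i \<or> p (Suc i) \<le> x"
      using p_le[of j i] p_le[of "Suc i" j] i j by (cases "j \<le> i") auto
    with x(2) p(5)[OF i] show ?thesis
      by (auto simp: dist_real_def y_def field_simps abs_if split: if_splits)
  qed
  define m where "m = (n + 1) div 2"
  define c where "c i = p (min (2 * i) n)" for i
  define t where "t i = p (2 * i + 1)" for i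
  define \<D> where "\<D> = (\<lambda>i. (t i, {c i..c (Suc i)})) ` {..<m}"
  have "min (2 * m) n = n"
    unfolding m_def by simp
  then have m: "0 < m" "c 0 = a" "c m = b"
    using p(1,3,4) by (auto simp: m_def c_def)
  have ct: "c i \<le> t i \<and> t i \<le> c (Suc i)" if "i < m" for i
    using that by (auto simp: c_def t_def m_def min_def intro!: p_le)
  have c_mesh: "c (Suc i) - c i < 5 * \<delta>" if "i < m" for i
  proof -
    have i: "2 * i < n"
      using that by (auto simp: m_def)
    have "c (Suc i) \<le> p (2 * i + 1) + 2 * \<delta>"
    proof (cases "2 * i + 1 < n")
      case True
      then show ?thesis
        using gap[of "2 * i + 1"] by (simp add: c_def min_def)
    next
      case False
      with i have "n = 2 * i + 1" by simp
      then show ?thesis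
        using gap[OF i] p(5)[OF i] by (simp add: c_def)
    qed
    then show ?thesis
      using gap[OF i] i p(5)[of "2 * i"] by (auto simp: c_def)
  qed
  show thesis
  proof
    show "\<D> tagged_division_of {a..b}"
      using tagged_division_of_nodes[of m c t] m ct by (simp add: \<D>_def)
    show "\<forall>(x, J)\<in>\<D>. measure lborel J < 5 * \<delta>"
      using c_mesh ct by (force simp: \<D>_def)
    \<comment> \<open>The Riemann sum runs over a set of pairs, so no two indices may give the same
      pair; the strictly increasing tags ensure this.\<close>
    have "inj_on (\<lambda>i. (t i, {c i..c (Suc i)})) {..<m}"
    proof (rule linorder_inj_onI')
      fix i j assume "i \<in> {..<m}" "j \<in> {..<m}" "i < j"
      then have "t i < t j"
        unfolding t_def by (intro p_less) (auto simp: m_def)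
      then show "(t i, {c i..c (Suc i)}) \<noteq> (t j, {c j..c (Suc j)})"
        by auto
    qed
    then have "(\<Sum>(x, J)\<in>\<D>. measure lborel J * f x) = (\<Sum>i<m. f (t i) * (c (Suc i) - c i))"
      unfolding \<D>_def by (subst sum.reindex) (use ct in \<open>force intro!: sum.cong\<close>)+
    also have "\<dots> = alternate_sum f (p 0) (p n) (p ` {..n})"
      by (subst alternate_sum_strictly_increasing)
         (use p(1,5) in \<open>auto simp: m_def c_def t_def intro!: sum.cong\<close>)
    \<comment> \<open>The alternate sum inserts both end points itself, so adding them to
      \<open>K\<close> beforehand changes nothing.\<close>
    also have "\<dots> = alternate_sum f a b K"
      unfolding p(2)[symmetric] p(3,4) alternate_sum_def by (simp add: insert_commute)
    finally show "alternate_sum f a b K = (\<Sum>(x, J)\<in>\<D>. measure lborel J * f x)" ..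
  qed
qed

section \<open>Equivalence of the two limits\<close>

theorem theorem4p17:
  fixes f :: "real \<Rightarrow> real" and a b A :: real
  assumes "a < b" and "bounded (f ` {a..b})"
  shows "has_riemann_integral f a b A \<longleftrightarrow> has_ext {a..b} dist (alternate_sum f a b) A"
proof
  assume R: "has_riemann_integral f a b A"
  show "has_ext {a..b} dist (alternate_sum f a b) A"
    unfolding has_ext_def
  proof (intro allI impI)
    fix \<epsilon> :: real assume "\<epsilon> > 0"
    then obtain \<delta> where \<delta>: "\<delta> > 0"
      "\<And>\<D>. \<D> tagged_division_of {a..b} \<Longrightarrow> \<forall>(x, K)\<in>\<D>. measure lborel K < \<delta> \<Longrightarrow>
        \<bar>(\<Sum>(x, K)\<in>\<D>. measure lborel K * f x) - A\<bar> < \<epsilon>"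
      using R unfolding has_riemann_integral_def by metis
    \<comment> \<open>Hausdorff distance below \<open>\<delta> / 5\<close> makes the pieces of the
      associated division shorter than \<delta>.\<close>
    have "\<bar>alternate_sum f a b K - A\<bar> < \<epsilon>"
      if K: "finite K" "K \<subseteq> {a..b}" "hausdorff_pmetric {a..b} dist K {a..b} < ereal (\<delta> / 5)" for K
    proof -
      obtain \<D> where "\<D> tagged_division_of {a..b}" "\<forall>(x, J)\<in>\<D>. measure lborel J < 5 * (\<delta> / 5)"
        "alternate_sum f a b K = (\<Sum>(x, J)\<in>\<D>. measure lborel J * f x)"
        by (rule alternate_sum_is_riemann_sum[OF assms(1) K])
      then show ?thesis
        using \<delta>(2)[of \<D>] by simp
    qed
    with \<delta>(1) show "\<exists>\<delta>>0. \<forall>K. finite K \<and> K \<subseteq> {a..b} \<and> hausdorff_pmetric {a..b} dist K {a..b} < ereal \<delta>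
        \<longrightarrow> \<bar>alternate_sum f a b K - A\<bar> < \<epsilon>"
      by (intro exI[of _ "\<delta> / 5"]) auto
  qed
next
  assume E: "has_ext {a..b} dist (alternate_sum f a b) A"
  obtain M where M: "0 < M" "\<And>x. x \<in> {a..b} \<Longrightarrow> \<bar>f x\<bar> \<le> M"
    using assms(2) by (auto simp: bounded_pos)
  show "has_riemann_integral f a b A"
    unfolding has_riemann_integral_def
  proof (intro allI impI)
    fix \<epsilon> :: real assume "\<epsilon> > 0"
    then have "\<epsilon> / 2 > 0" by simp
    then obtain \<delta> where \<delta>: "\<delta> > 0"
      "\<And>K. finite K \<Longrightarrow> K \<subseteq> {a..b} \<Longrightarrow> hausdorff_pmetric {a..b} dist K {a..b} < ereal \<delta> \<Longrightarrow>
        \<bar>alternate_sum f a b K - A\<bar> < \<epsilon> / 2"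
      using E unfolding has_ext_def by metis
    \<comment> \<open>The first bound brings the set of nodes and tags within Hausdorff distance
      \<delta>. The second leaves \<open>\<epsilon> / 2\<close> for the change of the sum; the other
      half is the distance of the alternate sum from \<open>A\<close>.\<close>
    define \<mu> where "\<mu> = min (\<delta> / 4) (\<epsilon> / (32 * M))"
    have \<mu>: "0 < \<mu>" "4 * \<mu> \<le> \<delta>"
      using \<delta>(1) M(1) \<open>\<epsilon> > 0\<close> by (auto simp: \<mu>_def)
    have "\<mu> \<le> \<epsilon> / (32 * M)"
      by (simp add: \<mu>_def)
    then have \<mu>M: "16 * M * \<mu> \<le> \<epsilon> / 2"
      using M(1) by (simp add: field_simps)
    have "\<bar>(\<Sum>(x, K)\<in>\<D>. measure lborel K * f x) - A\<bar> < \<epsilon>"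
      if D: "\<D> tagged_division_of {a..b}" "\<forall>(x, K)\<in>\<D>. measure lborel K < \<mu>" for \<D>
    proof -
      obtain K where "finite K" "K \<subseteq> {a..b}" "hausdorff_pmetric {a..b} dist K {a..b} < ereal \<delta>"
        "\<bar>(\<Sum>(x, K)\<in>\<D>. measure lborel K * f x) - alternate_sum f a b K\<bar> \<le> \<epsilon> / 2"
        by (rule tagged_division_near_alternate_sum[OF assms(1) D M(2) \<mu>(1) M(1) \<mu>(2) \<mu>M])
      then show ?thesis
        using \<delta>(2)[of K] by linarith
    qed
    with \<mu>(1) show "\<exists>\<delta>>0. \<forall>\<D>. \<D> tagged_division_of {a..b} \<and> (\<forall>(x, K)\<in>\<D>. measure lborel K < \<delta>)
        \<longrightarrow> \<bar>(\<Sum>(x, K)\<in>\<D>. measure lborel K * f x) - A\<bar> < \<epsilon>"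
      by blast
  qed
qed

end
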